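(* Let $\langle F,E\rangle$ be a $w^*$-sequentially complete anti-dual pair and let $A:E\supseteq\operatorname{dom}A\to F$ be a linear operator with domain $\operatorname{dom}A$, which is assumed to be only a linear subspace of $E$. Put $$W(A):=\{Ax : x\in\operatorname{dom}A,\ \langle Ax,x\rangle\leq 1\}\subseteq F.$$ Then the following statements are equivalent: (i) There is a positive operator $\widetilde A\in\mathscr{L}(E;F)$ extending $A$. (ii) $W(A)$ is $\beta(F,E)$-bounded in $F$. (iii) $W(A)$ is $\sigma(F,E)$-bounded in $F$. (iv) To any $y\in E$ there is $M_y\geq 0$ such that $|\langle Ax,y\rangle|^2\leq M_y\langle Ax,x\rangle$ for all $x\in\operatorname{dom}A$. If one (and hence all) of these conditions is satisfied, then there exists a distinguished positive extension $A_N\in\mathscr{L}(E;F)$ of $A$, called the Krein--von Neumann extension, which is minimal in the following sense: $A_N\leq\widetilde A$ holds for any positive extension $\widetilde A\in\mathscr{L}(E;F)$ of $A$.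
   Context: An anti-dual pair $\langle F,E\rangle$ consists of complex vector spaces $E,F$ and a map $\langle\cdot,\cdot\rangle:F\times E\to\mathbb{C}$, linear in the first and conjugate linear in the second variable, which separates the points of both spaces ($\langle f,x\rangle=0$ for all $x\in E$ implies $f=0$; $\langle f,x\rangle=0$ for all $f\in F$ implies $x=0$). $\sigma(E,F)$ is the smallest topology on $E$ making all maps $x\mapsto\langle f,x\rangle$ ($f\in F$) continuous; $\sigma(F,E)$ is the smallest topology on $F$ making all maps $f\mapsto\langle f,x\rangle$ ($x\in E$) continuous. The pair is $w^*$-sequentially complete if $(F,\sigma(F,E))$ is sequentially complete. The strong topology $\beta(F,E)$ on $F$ is the linear topology induced by the polars $B^\circ=\{f\in F: |\langle f,x\rangle|\leq 1\ \forall x\in B\}$ of the $\sigma(E,F)$-bounded subsets $B$ of $E$. $\mathscr{L}(E;F)$ denotes the set of everywhere defined linear operators $E\to F$ that are $\sigma(E,F)$-$\sigma(F,E)$ continuous. A linear operator $T:E\supseteq\operatorname{dom}T\to F$ is called positive if $\langle Tx,x\rangle\geq 0$ for all $x\in\operatorname{dom}T$. For $S,T\in\mathscr{L}(E;F)$, $S\leq T$ means $\langle (T-S)x,x\rangle\geq 0$ for all $x\in E$.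
   Formalization: The equivalence of (i)–(iv) is proved for A with ⟨Ax,x⟩ real on dom A; otherwise (ii),(iii) need not imply (i): E=F=ℂ, A=i·id has W(A)={0}. For arbitrary A: (i)⇔(iv), (ii)⇔(iii), (i)⇒(ii), and (i) gives the minimal extension. *)

theory Defs
  imports "HOL-Analysis.Analysis" "HOL-Library.Complex_Order"
begin

text \<open>
  Complex vector spaces are given by a scalar multiplication \<open>complex \<Rightarrow> 'a \<Rightarrow> 'a\<close> on an abelian
  group type.  Inequalities between complex numbers refer to the order of
  \<open>Complex_Order\<close>: \<open>z \<le> w\<close> iff \<open>w - z\<close> is a nonnegative real.
\<close>

locale anti_dual_pair =
  E: vector_space scaleE + F: vector_space scaleF
  for scaleE :: "complex \<Rightarrow> 'e::ab_group_add \<Rightarrow> 'e"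
    and scaleF :: "complex \<Rightarrow> 'f::ab_group_add \<Rightarrow> 'f" +
  fixes pairing :: "'f \<Rightarrow> 'e \<Rightarrow> complex"
  assumes pairing_add_left: "pairing (f + g) x = pairing f x + pairing g x"
    and pairing_scale_left: "pairing (scaleF c f) x = c * pairing f x"
    and pairing_add_right: "pairing f (x + y) = pairing f x + pairing f y"
    and pairing_scale_right: "pairing f (scaleE c x) = cnj c * pairing f x"
    and separates_F: "(\<forall>x. pairing f x = 0) \<Longrightarrow> f = 0"
    and separates_E: "(\<forall>f. pairing f x = 0) \<Longrightarrow> x = 0"


subsection \<open>Topological notions on a vector space\<close>

definition initial_topology :: "('a \<Rightarrow> complex) set \<Rightarrow> 'a topology" where
  "initial_topology \<Phi> = topology_generated_by {\<phi> -` U | \<phi> U. \<phi> \<in> \<Phi> \<and> open U}"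

lemma topspace_initial_topology:
  assumes "\<Phi> \<noteq> {}"
  shows "topspace (initial_topology \<Phi>) = UNIV"
proof -
  obtain \<phi> where "\<phi> \<in> \<Phi>" using assms by blast
  then have "\<phi> -` UNIV \<in> {\<phi> -` U | \<phi> U. \<phi> \<in> \<Phi> \<and> open U}" by blast
  then show ?thesis
    unfolding initial_topology_def topology_generated_by_topspace by auto
qed

lemma continuous_map_initial_topology:
  assumes "\<phi> \<in> \<Phi>"
  shows "continuous_map (initial_topology \<Phi>) euclidean \<phi>"
proof -
  have "openin (initial_topology \<Phi>) (\<phi> -` U)" if "open U" for U
    unfolding initial_topology_def
    by (rule topology_generated_by_Basis) (use assms that in blast)
  moreover have "topspace (initial_topology \<Phi>) = UNIV"
    using assms by (intro topspace_initial_topology) auto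
  ultimately show ?thesis
    by (auto simp: continuous_map_def vimage_def)
qed

lemma initial_topology_least:
  assumes "topspace X = UNIV" and "\<And>\<phi>. \<phi> \<in> \<Phi> \<Longrightarrow> continuous_map X euclidean \<phi>"
    and "openin (initial_topology \<Phi>) V"
  shows "openin X V"
proof -
  have "generate_topology_on {\<phi> -` U | \<phi> U. \<phi> \<in> \<Phi> \<and> open U} V"
    using assms(3) by (simp add: initial_topology_def openin_topology_generated_by_iff)
  then show ?thesis
  proof induction
    case (Basis s)
    then obtain \<phi> U where "s = \<phi> -` U" "\<phi> \<in> \<Phi>" "open U" by blast
    then show ?case
      using assms(1,2) by (auto simp: continuous_map_def vimage_def)
  qed auto
qed

definition vs_Cauchy :: "'a::ab_group_add topology \<Rightarrow> (nat \<Rightarrow> 'a) \<Rightarrow> bool" where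
  "vs_Cauchy X s \<longleftrightarrow>
     (\<forall>U. openin X U \<and> 0 \<in> U \<longrightarrow> (\<exists>N. \<forall>m\<ge>N. \<forall>n\<ge>N. s m - s n \<in> U))"

definition sequentially_complete :: "'a::ab_group_add topology \<Rightarrow> bool" where
  "sequentially_complete X \<longleftrightarrow>
     (\<forall>s. vs_Cauchy X s \<longrightarrow> (\<exists>l. limitin X s l sequentially))"

definition vs_bounded ::
    "(complex \<Rightarrow> 'a::ab_group_add \<Rightarrow> 'a) \<Rightarrow> 'a topology \<Rightarrow> 'a set \<Rightarrow> bool" where
  "vs_bounded sc X S \<longleftrightarrow>
     (\<forall>U. openin X U \<and> 0 \<in> U \<longrightarrow> (\<exists>r>0. \<forall>c. r \<le> cmod c \<longrightarrow> S \<subseteq> sc c ` U))"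


subsection \<open>Topologies of an anti-dual pair\<close>

definition weak_topology :: "('f \<Rightarrow> 'e \<Rightarrow> complex) \<Rightarrow> 'e topology" where
  "weak_topology pairing = initial_topology (range (\<lambda>f x. pairing f x))"

definition weak_star_topology :: "('f \<Rightarrow> 'e \<Rightarrow> complex) \<Rightarrow> 'f topology" where
  "weak_star_topology pairing = initial_topology (range (\<lambda>x f. pairing f x))"

definition polar :: "('f \<Rightarrow> 'e \<Rightarrow> complex) \<Rightarrow> 'e set \<Rightarrow> 'f set" where
  "polar pairing B = {f. \<forall>x\<in>B. cmod (pairing f x) \<le> 1}"

text \<open>
  The weakly bounded sets are closed under scaling and finite unions, so their polars already
  form a base of neighbourhoods of 0 and no finite intersections of multiples are needed.
\<close>

definition strong_topology ::
    "(complex \<Rightarrow> 'e::ab_group_add \<Rightarrow> 'e) \<Rightarrow> ('f::ab_group_add \<Rightarrow> 'e \<Rightarrow> complex) \<Rightarrow> 'f topology" where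
  "strong_topology scaleE pairing = topology (\<lambda>U. \<forall>f\<in>U. \<exists>B.
     vs_bounded scaleE (weak_topology pairing) B \<and> (+) f ` polar pairing B \<subseteq> U)"

lemma openin_strong_topology:
  "openin (strong_topology scaleE pairing) U \<longleftrightarrow>
     (\<forall>f\<in>U. \<exists>B. vs_bounded scaleE (weak_topology pairing) B \<and> (+) f ` polar pairing B \<subseteq> U)"
proof -
  let ?b = "vs_bounded scaleE (weak_topology pairing)"
  let ?P = "\<lambda>U. \<forall>f\<in>U. \<exists>B. ?b B \<and> (+) f ` polar pairing B \<subseteq> U"
  have un: "?b (B \<union> C)" if B: "?b B" and C: "?b C" for B C
    unfolding vs_bounded_def
  proof (intro allI impI)
    fix U assume U: "openin (weak_topology pairing) U \<and> 0 \<in> U"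
    obtain r where r: "r > 0" "\<forall>c. r \<le> cmod c \<longrightarrow> B \<subseteq> scaleE c ` U"
      using B U unfolding vs_bounded_def by blast
    obtain s where s: "s > 0" "\<forall>c. s \<le> cmod c \<longrightarrow> C \<subseteq> scaleE c ` U"
      using C U unfolding vs_bounded_def by blast
    have "max r s > 0" using r by simp
    moreover have "B \<union> C \<subseteq> scaleE c ` U" if "max r s \<le> cmod c" for c
    proof (rule Un_least)
      show "B \<subseteq> scaleE c ` U" using r(2) that by simp
      show "C \<subseteq> scaleE c ` U" using s(2) that by simp
    qed
    ultimately show "\<exists>r>0. \<forall>c. r \<le> cmod c \<longrightarrow> B \<union> C \<subseteq> scaleE c ` U" by blast
  qed
  have "istopology ?P"
    unfolding istopology_def
  proof (intro conjI allI impI)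
    fix S T assume S: "?P S" and T: "?P T"
    show "?P (S \<inter> T)"
    proof
      fix f assume f: "f \<in> S \<inter> T"
      obtain B where B: "?b B" "(+) f ` polar pairing B \<subseteq> S" using S f by blast
      obtain C where C: "?b C" "(+) f ` polar pairing C \<subseteq> T" using T f by blast
      have "polar pairing (B \<union> C) \<subseteq> polar pairing B \<inter> polar pairing C"
        by (auto simp: polar_def)
      then have "(+) f ` polar pairing (B \<union> C) \<subseteq> S \<inter> T" using B C by blast
      then show "\<exists>B. ?b B \<and> (+) f ` polar pairing B \<subseteq> S \<inter> T" using un B C by blast
    qed
  next
    fix \<K> assume K: "\<forall>K\<in>\<K>. ?P K"
    show "?P (\<Union>\<K>)"
    proof
      fix f assume "f \<in> \<Union>\<K>"
      then obtain K where "K \<in> \<K>" "f \<in> K" by blast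
      with K obtain B where "?b B" "(+) f ` polar pairing B \<subseteq> K" by blast
      with \<open>K \<in> \<K>\<close> show "\<exists>B. ?b B \<and> (+) f ` polar pairing B \<subseteq> \<Union>\<K>" by blast
    qed
  qed
  then show ?thesis
    unfolding strong_topology_def by (simp add: topology_inverse')
qed

definition weak_star_sequentially_complete ::
    "('f::ab_group_add \<Rightarrow> 'e \<Rightarrow> complex) \<Rightarrow> bool" where
  "weak_star_sequentially_complete pairing \<longleftrightarrow> sequentially_complete (weak_star_topology pairing)"


subsection \<open>Operators\<close>

text \<open>
  An operator from \<open>D \<subseteq> E\<close> to \<open>F\<close> is a function on the whole type together with its domain \<open>D\<close>;
  its values outside \<open>D\<close> are irrelevant everywhere below.
\<close>

definition linear_operator ::
    "(complex \<Rightarrow> 'e::ab_group_add \<Rightarrow> 'e) \<Rightarrow> (complex \<Rightarrow> 'f::ab_group_add \<Rightarrow> 'f) \<Rightarrow>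
     'e set \<Rightarrow> ('e \<Rightarrow> 'f) \<Rightarrow> bool" where
  "linear_operator scaleE scaleF D A \<longleftrightarrow>
     module.subspace scaleE D \<and>
     (\<forall>x\<in>D. \<forall>y\<in>D. A (x + y) = A x + A y) \<and>
     (\<forall>c. \<forall>x\<in>D. A (scaleE c x) = scaleF c (A x))"

definition positive_operator :: "('f \<Rightarrow> 'e \<Rightarrow> complex) \<Rightarrow> 'e set \<Rightarrow> ('e \<Rightarrow> 'f) \<Rightarrow> bool" where
  "positive_operator pairing D A \<longleftrightarrow> (\<forall>x\<in>D. 0 \<le> pairing (A x) x)"

definition continuous_operators ::
    "(complex \<Rightarrow> 'e::ab_group_add \<Rightarrow> 'e) \<Rightarrow> (complex \<Rightarrow> 'f::ab_group_add \<Rightarrow> 'f) \<Rightarrow>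
     ('f \<Rightarrow> 'e \<Rightarrow> complex) \<Rightarrow> ('e \<Rightarrow> 'f) set" where
  "continuous_operators scaleE scaleF pairing =
     {T. linear_operator scaleE scaleF UNIV T \<and>
         continuous_map (weak_topology pairing) (weak_star_topology pairing) T}"

definition operator_le ::
    "('f::ab_group_add \<Rightarrow> 'e \<Rightarrow> complex) \<Rightarrow> ('e \<Rightarrow> 'f) \<Rightarrow> ('e \<Rightarrow> 'f) \<Rightarrow> bool" where
  "operator_le pairing S T \<longleftrightarrow> (\<forall>x. 0 \<le> pairing (T x - S x) x)"

definition positive_extension ::
    "(complex \<Rightarrow> 'e::ab_group_add \<Rightarrow> 'e) \<Rightarrow> (complex \<Rightarrow> 'f::ab_group_add \<Rightarrow> 'f) \<Rightarrow>
     ('f \<Rightarrow> 'e \<Rightarrow> complex) \<Rightarrow> 'e set \<Rightarrow> ('e \<Rightarrow> 'f) \<Rightarrow> ('e \<Rightarrow> 'f) \<Rightarrow> bool" where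
  "positive_extension scaleE scaleF pairing D A T \<longleftrightarrow>
     T \<in> continuous_operators scaleE scaleF pairing \<and>
     positive_operator pairing UNIV T \<and> (\<forall>x\<in>D. T x = A x)"

definition W_set :: "('f \<Rightarrow> 'e \<Rightarrow> complex) \<Rightarrow> 'e set \<Rightarrow> ('e \<Rightarrow> 'f) \<Rightarrow> 'f set" where
  "W_set pairing D A = {A x | x. x \<in> D \<and> pairing (A x) x \<le> 1}"

text \<open>
  Writing \<open>\<langle>Ax,x\<rangle> \<le> 1\<close> for all \<open>x\<close> in the domain presupposes that \<open>\<langle>Ax,x\<rangle>\<close> is real there.  This
  presupposition cannot be dropped when passing from boundedness of \<open>W_set\<close> to a positive
  extension: for \<open>E = F = \<complex>\<close>, \<open>\<langle>f,x\<rangle> = f * cnj x\<close> and \<open>A x = \<i> * x\<close> the set is \<open>{0}\<close>, but \<open>A\<close> is not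
  positive.  Positivity of \<open>A\<close> itself need not be assumed.
\<close>

definition real_form :: "('f \<Rightarrow> 'e \<Rightarrow> complex) \<Rightarrow> 'e set \<Rightarrow> ('e \<Rightarrow> 'f) \<Rightarrow> bool" where
  "real_form pairing D A \<longleftrightarrow> (\<forall>x\<in>D. pairing (A x) x \<in> \<real>)"

end

theory Submission
  imports Defs
begin

text \<open>
  A positive operator satisfies the Cauchy--Schwarz inequality, which gives (iv), and (iv) bounds
  \<open>W(A)\<close> pointwise.  Weak* sequential completeness upgrades pointwise to strong boundedness by a
  gliding hump argument (Banach--Mackey).  Given (iv), \<open>A\<close> is positive and each functional
  \<open>x \<mapsto> \<langle>Ax,y\<rangle>\<close> is bounded for the seminorm \<open>sqrt \<langle>Ax,x\<rangle>\<close> on the domain, so there are \<open>v n\<close> in the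
  domain for which \<open>\<langle>Ax, v n\<rangle>\<close> tends to \<open>\<langle>Ax,y\<rangle>\<close> uniformly on the unit ball of that seminorm.  Then
  \<open>A (v n)\<close> is weak* Cauchy, and its limit is the value at \<open>y\<close> of the Krein--von Neumann extension;
  this replaces the factorisation through the Hilbert space completion.
\<close>

section \<open>Discriminant of a complex quadratic polynomial\<close>

text \<open>Minimising over \<open>c\<close> is the complex version of the discriminant argument. It
  yields both the Cauchy--Schwarz inequality and the approximate representation of
  functionals.\<close>

lemma quadratic_nonneg_imp:
  fixes d :: complex and a e :: real
  assumes "a \<ge> 0" and nonneg: "\<And>c. 0 \<le> (cmod c)\<^sup>2 * a + 2 * Re (c * d) + e"
  shows "(cmod d)\<^sup>2 \<le> a * e"
proof (cases "a = 0")
  case True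
  \<comment> \<open>With no quadratic term, the polynomial decreases without bound along real
    multiples of \<open>cnj d\<close> unless \<open>d = 0\<close>.\<close>
  have le: "2 * t * (cmod d)\<^sup>2 \<le> e" for t :: real
  proof -
    have "Re (- (of_real t * cnj d) * d) = - t * (cmod d)\<^sup>2"
      by (simp add: cmod_power2) (simp add: power2_eq_square algebra_simps)
    then show ?thesis using nonneg[of "- (of_real t * cnj d)"] True by simp
  qed
  have "d = 0"
  proof (rule ccontr)
    assume "d \<noteq> 0"
    then have "(cmod d)\<^sup>2 > 0" by simp
    then show False
      using le[of "(e + 1) / (2 * (cmod d)\<^sup>2)"] by (simp add: field_simps)
  qed
  then show ?thesis using True by simp
next
  case False
  with assms have a: "a > 0" by simp
  \<comment> \<open>The minimiser of the polynomial; its value there is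
    \<open>e - (cmod d)\<^sup>2 / a\<close>.\<close>
  let ?c = "- (cnj d / of_real a)"
  have 1: "(cmod ?c)\<^sup>2 * a = (cmod d)\<^sup>2 / a"
    using a by (simp add: norm_divide power_divide power2_eq_square)
  have 2: "Re (?c * d) = - ((cmod d)\<^sup>2 / a)"
    using a by (simp add: cmod_power2) (simp add: power2_eq_square field_simps)
  have "(cmod d)\<^sup>2 / a \<le> e" using nonneg[of ?c] unfolding 1 2 by simp
  then show ?thesis using a by (simp add: field_simps)
qed

section \<open>Initial topologies\<close>

text \<open>The generating preimages form a subbase, so finitely many functions and a single radius
  suffice at each point. In the induction, an intersection merges the two finite families and takes
  the smaller radius.\<close>

lemma openin_initial_topology_nhd:
  assumes "openin (initial_topology \<Phi>) V" and "x \<in> V"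
  obtains T e where "finite T" "T \<subseteq> \<Phi>" "e > 0" "{y. \<forall>\<phi>\<in>T. dist (\<phi> y) (\<phi> x) < e} \<subseteq> V"
proof -
  have "generate_topology_on {\<phi> -` U | \<phi> U. \<phi> \<in> \<Phi> \<and> open U} V"
    using assms(1) by (simp add: initial_topology_def openin_topology_generated_by_iff)
  then have "\<exists>T e. finite T \<and> T \<subseteq> \<Phi> \<and> e > 0 \<and> {y. \<forall>\<phi>\<in>T. dist (\<phi> y) (\<phi> x) < e} \<subseteq> V"
    using assms(2)
  proof induction
    case Empty
    then show ?case by simp
  next
    case (Int a b)
    from Int obtain S d where 1: "finite S" "S \<subseteq> \<Phi>" "d > 0" "{y. \<forall>\<phi>\<in>S. dist (\<phi> y) (\<phi> x) < d} \<subseteq> a"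
      by auto
    from Int obtain T e where 2: "finite T" "T \<subseteq> \<Phi>" "e > 0" "{y. \<forall>\<phi>\<in>T. dist (\<phi> y) (\<phi> x) < e} \<subseteq> b"
      by auto
    show ?case
      using 1 2 by (intro exI[of _ "S \<union> T"] exI[of _ "min d e"]) (auto simp: subset_iff)
  next
    case (UN K)
    then obtain k where k: "k \<in> K" "x \<in> k" by blast
    with UN obtain T e where "finite T" "T \<subseteq> \<Phi>" "e > 0" "{y. \<forall>\<phi>\<in>T. dist (\<phi> y) (\<phi> x) < e} \<subseteq> k"
      by meson
    with k show ?case by (intro exI[of _ T] exI[of _ e]) auto
  next
    case (Basis s)
    then obtain \<phi> U where s: "s = \<phi> -` U" "\<phi> \<in> \<Phi>" "open U" by blast
    have "\<phi> x \<in> U" using Basis.prems s(1) by simp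
    with s(3) obtain e where "e > 0" "\<forall>z. dist z (\<phi> x) < e \<longrightarrow> z \<in> U"
      unfolding open_dist by blast
    with s show ?case by (intro exI[of _ "{\<phi>}"] exI[of _ e]) auto
  qed
  then show thesis using that by blast
qed

text \<open>Absolute homogeneity is shared by linear and conjugate linear functionals, so one
  criterion serves the weak topologies of both spaces.\<close>

lemma vs_bounded_initial_topology_iff:
  assumes "vector_space sc"
    and hom: "\<And>\<phi> c x. \<phi> \<in> \<Phi> \<Longrightarrow> cmod (\<phi> (sc c x)) = cmod c * cmod (\<phi> x)"
  shows "vs_bounded sc (initial_topology \<Phi>) S \<longleftrightarrow> (\<forall>\<phi>\<in>\<Phi>. \<exists>C. \<forall>s\<in>S. cmod (\<phi> s) \<le> C)"
proof -
  interpret vector_space sc by fact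
  have zero: "\<phi> 0 = 0" if "\<phi> \<in> \<Phi>" for \<phi>
    using hom[OF that, of 0 0] by simp
  show ?thesis
  proof (intro iffI ballI)
    fix \<phi> assume b: "vs_bounded sc (initial_topology \<Phi>) S" and \<phi>: "\<phi> \<in> \<Phi>"
    have "openin (initial_topology \<Phi>) (\<phi> -` ball 0 1)"
      unfolding initial_topology_def
      by (rule topology_generated_by_Basis) (use \<phi> open_ball in blast)
    moreover have "0 \<in> \<phi> -` ball 0 1" using zero[OF \<phi>] by simp
    ultimately obtain r where r: "r > 0" "\<forall>c. r \<le> cmod c \<longrightarrow> S \<subseteq> sc c ` (\<phi> -` ball 0 1)"
      using b unfolding vs_bounded_def by meson
    have "cmod (\<phi> s) \<le> r" if "s \<in> S" for s
    proof -
      have "s \<in> sc (of_real r) ` (\<phi> -` ball 0 1)" using r that by force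
      then obtain u where "s = sc (of_real r) u" "u \<in> \<phi> -` ball 0 1" by blast
      then have u: "s = sc (of_real r) u" "cmod (\<phi> u) < 1" by simp_all
      then show ?thesis
        using hom[OF \<phi>, of "of_real r" u] r(1) by (simp add: mult_left_le)
    qed
    then show "\<exists>C. \<forall>s\<in>S. cmod (\<phi> s) \<le> C" by blast
  next
    assume C: "\<forall>\<phi>\<in>\<Phi>. \<exists>C. \<forall>s\<in>S. cmod (\<phi> s) \<le> C"
    show "vs_bounded sc (initial_topology \<Phi>) S"
      unfolding vs_bounded_def
    proof (intro allI impI)
      fix U assume U: "openin (initial_topology \<Phi>) U \<and> 0 \<in> U"
      obtain T e where T: "finite T" "T \<subseteq> \<Phi>" "e > 0"
          "{y. \<forall>\<phi>\<in>T. dist (\<phi> y) (\<phi> 0) < e} \<subseteq> U"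
        by (rule openin_initial_topology_nhd[OF conjunct1[OF U] conjunct2[OF U]]) blast
      have "\<exists>K\<ge>0. \<forall>\<phi>\<in>T. \<forall>s\<in>S. cmod (\<phi> s) \<le> K"
        using T(1,2)
      proof (induction T)
        case (insert \<phi> T)
        then obtain K where K: "K \<ge> 0" "\<forall>\<phi>\<in>T. \<forall>s\<in>S. cmod (\<phi> s) \<le> K" by auto
        obtain C where "\<forall>s\<in>S. cmod (\<phi> s) \<le> C" using C insert by auto
        with K show ?case by (intro exI[of _ "max K C"]) (auto simp: le_max_iff_disj)
      qed auto
      then obtain K where K: "K \<ge> 0" "\<And>\<phi> s. \<phi> \<in> T \<Longrightarrow> s \<in> S \<Longrightarrow> cmod (\<phi> s) \<le> K" by blast
      \<comment> \<open>Adding 1 to \<open>K\<close> makes the threshold positive and the resulting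
        estimate \<open>K < cmod c * e\<close> strict, also when \<open>K = 0\<close>.\<close>
      have "s \<in> sc c ` U" if c: "(K + 1) / e \<le> cmod c" and s: "s \<in> S" for c s
      proof -
        have "0 < (K + 1) / e" using K(1) T(3) by simp
        then have pos: "cmod c > 0" using c by linarith
        have "cmod (\<phi> (sc (1 / c) s)) < e" if \<phi>: "\<phi> \<in> T" for \<phi>
        proof -
          have "K < cmod c * e" using c T(3) by (simp add: field_simps)
          then have "cmod (\<phi> s) < cmod c * e" using K(2)[OF \<phi> s] by linarith
          then show ?thesis
            using hom[of \<phi> "1 / c" s] \<phi> T(2) pos by (simp add: subset_iff norm_divide divide_less_eq mult.commute)
        qed
        moreover have "\<phi> 0 = 0" if "\<phi> \<in> T" for \<phi> using zero T(2) that by blast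
        ultimately have "dist (\<phi> (sc (1 / c) s)) (\<phi> 0) < e" if "\<phi> \<in> T" for \<phi>
          using that by (metis dist_0_norm dist_commute)
        then have "sc (1 / c) s \<in> U" using T(4) by blast
        then show ?thesis using pos by (intro image_eqI[of _ _ "sc (1 / c) s"]) auto
      qed
      moreover have "(K + 1) / e > 0" using K(1) T(3) by simp
      ultimately show "\<exists>r>0. \<forall>c. r \<le> cmod c \<longrightarrow> S \<subseteq> sc c ` U" by blast
    qed
  qed
qed

text \<open>A neighbourhood of 0 constrains only finitely many functionals, so the largest of their
  Cauchy indices works.\<close>

lemma vs_Cauchy_initial_topology:
  assumes diff: "\<And>\<phi> x y. \<phi> \<in> \<Phi> \<Longrightarrow> \<phi> (x - y) = \<phi> x - \<phi> y"
    and "\<And>\<phi>. \<phi> \<in> \<Phi> \<Longrightarrow> Cauchy (\<lambda>n. \<phi> (s n))"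
  shows "vs_Cauchy (initial_topology \<Phi>) s"
  unfolding vs_Cauchy_def
proof (intro allI impI)
  fix U assume U: "openin (initial_topology \<Phi>) U \<and> 0 \<in> U"
  obtain T e where T: "finite T" "T \<subseteq> \<Phi>" "e > 0" "{y. \<forall>\<phi>\<in>T. dist (\<phi> y) (\<phi> 0) < e} \<subseteq> U"
    by (rule openin_initial_topology_nhd[OF conjunct1[OF U] conjunct2[OF U]]) blast
  have "\<exists>N. \<forall>m\<ge>N. \<forall>n\<ge>N. \<forall>\<phi>\<in>T. dist (\<phi> (s m)) (\<phi> (s n)) < e"
    using T(1,2)
  proof (induction T)
    case (insert \<phi> T)
    then obtain N where N: "\<forall>m\<ge>N. \<forall>n\<ge>N. \<forall>\<phi>\<in>T. dist (\<phi> (s m)) (\<phi> (s n)) < e" by auto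
    obtain N' where "\<forall>m\<ge>N'. \<forall>n\<ge>N'. dist (\<phi> (s m)) (\<phi> (s n)) < e"
      using assms(2)[of \<phi>] insert T(3) unfolding Cauchy_def by blast
    with N show ?case by (intro exI[of _ "max N N'"]) auto
  qed auto
  then obtain N where N: "\<And>m n \<phi>. m \<ge> N \<Longrightarrow> n \<ge> N \<Longrightarrow> \<phi> \<in> T \<Longrightarrow> dist (\<phi> (s m)) (\<phi> (s n)) < e"
    by blast
  have "s m - s n \<in> U" if "m \<ge> N" "n \<ge> N" for m n
  proof -
    have "dist (\<phi> (s m - s n)) (\<phi> 0) < e" if \<phi>: "\<phi> \<in> T" for \<phi>
    proof -
      have "\<phi> \<in> \<Phi>" using \<phi> T(2) by blast
      from diff[OF this, of "s m" "s n"] diff[OF this, of 0 0] show ?thesis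
        using N[OF \<open>m \<ge> N\<close> \<open>n \<ge> N\<close> \<phi>] by (simp add: dist_norm)
    qed
    then show ?thesis using T(4) by blast
  qed
  then show "\<exists>N. \<forall>m\<ge>N. \<forall>n\<ge>N. s m - s n \<in> U" by blast
qed

context anti_dual_pair
begin

section \<open>Pairings and boundedness\<close>

lemma pairing_0_right [simp]: "pairing f 0 = 0"
  using pairing_add_right[of f 0 0] by simp

lemma pairing_diff_left: "pairing (f - g) x = pairing f x - pairing g x"
  using pairing_add_left[of "f - g" g x] by simp

lemma pairing_diff_right: "pairing f (x - y) = pairing f x - pairing f y"
  using pairing_add_right[of f "x - y" y] by simp

lemma vs_bounded_weak_star_iff:
  "vs_bounded scaleF (weak_star_topology pairing) S \<longleftrightarrow> (\<forall>x. \<exists>C. \<forall>f\<in>S. cmod (pairing f x) \<le> C)"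
  unfolding weak_star_topology_def
  by (subst vs_bounded_initial_topology_iff)
    (auto simp: pairing_scale_left norm_mult F.vector_space_axioms)

lemma vs_bounded_weak_iff:
  "vs_bounded scaleE (weak_topology pairing) S \<longleftrightarrow> (\<forall>f. \<exists>C. \<forall>x\<in>S. cmod (pairing f x) \<le> C)"
  unfolding weak_topology_def
  by (subst vs_bounded_initial_topology_iff)
    (auto simp: pairing_scale_right norm_mult E.vector_space_axioms)

text \<open>The form in which completeness enters: the sum in the gliding hump argument and the
  values of the extension are both obtained as such pointwise limits.\<close>

lemma weak_star_limit:
  assumes "weak_star_sequentially_complete pairing"
    and "\<And>x. Cauchy (\<lambda>n. pairing (s n) x)"
  obtains f where "\<And>x. (\<lambda>n. pairing (s n) x) \<longlonglongrightarrow> pairing f x"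
proof -
  have "vs_Cauchy (weak_star_topology pairing) s"
    unfolding weak_star_topology_def
    by (rule vs_Cauchy_initial_topology) (auto simp: pairing_diff_left assms(2))
  then obtain f where f: "limitin (weak_star_topology pairing) s f sequentially"
    using assms(1) unfolding weak_star_sequentially_complete_def sequentially_complete_def by blast
  have "(\<lambda>n. pairing (s n) x) \<longlonglongrightarrow> pairing f x" for x
  proof -
    have "continuous_map (weak_star_topology pairing) euclidean (\<lambda>f. pairing f x)"
      unfolding weak_star_topology_def by (rule continuous_map_initial_topology) blast
    from continuous_map_limit[OF this f] show ?thesis by (simp add: o_def)
  qed
  then show thesis using that by blast
qed

text \<open>Singletons are weakly bounded, and polars of their multiples lie in the basic weak-star
  neighbourhoods of 0.\<close>

lemma strong_topology_finer_weak_star: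
  assumes "openin (weak_star_topology pairing) V"
  shows "openin (strong_topology scaleE pairing) V"
proof -
  have bsing: "vs_bounded scaleE (weak_topology pairing) {x}" for x
    by (auto simp: vs_bounded_weak_iff)
  have top: "topspace (strong_topology scaleE pairing) = UNIV"
  proof -
    have "openin (strong_topology scaleE pairing) UNIV"
      unfolding openin_strong_topology using bsing by blast
    then show ?thesis by (metis openin_subset subset_antisym subset_UNIV)
  qed
  have "continuous_map (strong_topology scaleE pairing) euclidean (\<lambda>f. pairing f x)" for x
    unfolding continuous_map_def
  proof (intro conjI allI impI)
    fix U :: "complex set" assume "openin euclidean U"
    then have U: "open U" by simp
    show "openin (strong_topology scaleE pairing)
            {f \<in> topspace (strong_topology scaleE pairing). pairing f x \<in> U}"
      unfolding openin_strong_topology top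
    proof
      fix f assume "f \<in> {f \<in> UNIV. pairing f x \<in> U}"
      then obtain e where e: "e > 0" "\<And>z. dist z (pairing f x) < e \<Longrightarrow> z \<in> U"
        using U by (auto simp: open_dist)
      \<comment> \<open>The factor \<open>2 / e\<close> bounds \<open>cmod (pairing g x)\<close> by
        \<open>e / 2\<close>, which is strictly below \<open>e\<close>.\<close>
      have "pairing (f + g) x \<in> U" if "g \<in> polar pairing {scaleE (of_real (2 / e)) x}" for g
      proof (rule e(2))
        have "cmod (pairing g x) * 2 \<le> e"
          using that e(1) by (simp add: polar_def pairing_scale_right norm_mult norm_divide field_simps)
        then show "dist (pairing (f + g) x) (pairing f x) < e"
          using e(1) by (simp add: dist_norm pairing_add_left)
      qed
      then show "\<exists>B. vs_bounded scaleE (weak_topology pairing) B \<and>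
                  (+) f ` polar pairing B \<subseteq> {f \<in> UNIV. pairing f x \<in> U}"
        using bsing by blast
    qed
  qed auto
  then have "continuous_map (strong_topology scaleE pairing) euclidean \<phi>"
    if "\<phi> \<in> range (\<lambda>x f. pairing f x)" for \<phi>
    using that by blast
  from initial_topology_least[OF top this] assms show ?thesis
    unfolding weak_star_topology_def by blast
qed

lemma vs_bounded_strong_imp_weak_star:
  assumes "vs_bounded scaleF (strong_topology scaleE pairing) S"
  shows "vs_bounded scaleF (weak_star_topology pairing) S"
  unfolding vs_bounded_def
proof (intro allI impI)
  fix U assume "openin (weak_star_topology pairing) U \<and> 0 \<in> U"
  then have "openin (strong_topology scaleE pairing) U \<and> 0 \<in> U"
    using strong_topology_finer_weak_star by simp
  then show "\<exists>r>0. \<forall>c. r \<le> cmod c \<longrightarrow> S \<subseteq> scaleF c ` U"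
    by (rule assms[unfolded vs_bounded_def, rule_format])
qed

text \<open>Each strong neighbourhood of 0 contains the polar of some weakly bounded
  \<open>B\<close>. Dividing by a scalar at least as large as the bound on \<open>B\<close> moves
  \<open>S\<close> into that polar; the 1 in the threshold keeps the scalar away from 0.\<close>

lemma vs_bounded_strongI:
  assumes S: "\<And>B. vs_bounded scaleE (weak_topology pairing) B \<Longrightarrow>
      \<exists>C. \<forall>f\<in>S. \<forall>x\<in>B. cmod (pairing f x) \<le> C"
  shows "vs_bounded scaleF (strong_topology scaleE pairing) S"
  unfolding vs_bounded_def
proof (intro allI impI)
  fix U assume "openin (strong_topology scaleE pairing) U \<and> 0 \<in> U"
  then obtain B where "vs_bounded scaleE (weak_topology pairing) B" "(+) 0 ` polar pairing B \<subseteq> U"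
    unfolding openin_strong_topology by blast
  then have B: "vs_bounded scaleE (weak_topology pairing) B" "polar pairing B \<subseteq> U" by auto
  obtain C where C: "\<And>f x. f \<in> S \<Longrightarrow> x \<in> B \<Longrightarrow> cmod (pairing f x) \<le> C"
    using S[OF B(1)] by blast
  have "f \<in> scaleF c ` U" if c: "max 1 C \<le> cmod c" and f: "f \<in> S" for c f
  proof -
    have "cmod (pairing f x) \<le> cmod c" if "x \<in> B" for x
      using C[OF f that] c by linarith
    then have "scaleF (1 / c) f \<in> polar pairing B"
      using c by (auto simp: polar_def pairing_scale_left norm_mult norm_divide divide_simps)
    moreover have "f = scaleF c (scaleF (1 / c) f)" using c by auto
    ultimately show ?thesis using B(2) by blast
  qed
  moreover have "max 1 C > 0" by simp
  ultimately show "\<exists>r>0. \<forall>c. r \<le> cmod c \<longrightarrow> S \<subseteq> scaleF c ` U" by blast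
qed

section \<open>The Banach--Mackey argument\<close>

text \<open>
  Gliding hump: if \<open>S\<close> were not uniformly bounded on \<open>B\<close>, a fast converging series
  \<open>\<Sum>n. c n * w n\<close> with \<open>w n \<in> S\<close> would have a sum that is unbounded on \<open>B\<close>.
\<close>

lemma weak_star_bounded_imp_uniformly_bounded:
  assumes complete: "weak_star_sequentially_complete pairing"
    and S: "\<And>x. \<exists>C. \<forall>f\<in>S. cmod (pairing f x) \<le> C"
    and B: "\<And>f. \<exists>C. \<forall>x\<in>B. cmod (pairing f x) \<le> C"
  shows "\<exists>C. \<forall>f\<in>S. \<forall>x\<in>B. cmod (pairing f x) \<le> C"
proof (rule ccontr)
  assume neg: "\<not> ?thesis"
  obtain q0 where q0: "\<And>x f. f \<in> S \<Longrightarrow> cmod (pairing f x) \<le> q0 x" using S by metis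
  define q where "q x = max 0 (q0 x)" for x
  have q: "q x \<ge> 0" "f \<in> S \<Longrightarrow> cmod (pairing f x) \<le> q x" for x f
    using q0[of f x] by (auto simp: q_def)
  obtain p where p: "\<And>f x. x \<in> B \<Longrightarrow> cmod (pairing f x) \<le> p f" using B by metis
  \<comment> \<open>A state consists of a partial sum and the coefficient of the next term.
    \<open>Q\<close> makes the new partial sum at least \<open>n + 2\<close> at some
    \<open>b\<close>, and makes the new coefficient so small that all later terms together change
    the value at \<open>b\<close> by at most 1.\<close>
  define P :: "nat \<Rightarrow> 'f \<times> real \<Rightarrow> bool" where "P n t \<longleftrightarrow> snd t > 0" for n t
  define Q where "Q n t t' \<longleftrightarrow> (\<exists>w\<in>S. \<exists>b\<in>B. fst t' = fst t + scaleF (of_real (snd t)) w \<and>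
      real n + 2 \<le> cmod (pairing (fst t') b) \<and> 2 * snd t' * q b \<le> 1) \<and> 2 * snd t' \<le> snd t"
    for n :: nat and t t' :: "'f \<times> real"
  have "\<exists>g. \<forall>n. P n (g n) \<and> Q n (g n) (g (Suc n))"
  proof (rule dependent_nat_choice)
    show "\<exists>t. P 0 t" by (rule exI[of _ "(0, 1)"]) (simp add: P_def)
  next
    fix t n assume "P n t"
    then have c: "snd t > 0" by (simp add: P_def)
    \<comment> \<open>The summand \<open>p (fst t)\<close> outweighs whatever the earlier partial
      sum contributes at \<open>b\<close>.\<close>
    obtain w b where w: "w \<in> S" "b \<in> B" "(p (fst t) + real n + 2) / snd t < cmod (pairing w b)"
      using neg by (meson not_le)
    \<comment> \<open>The first entry halves the coefficient, the second controls the effect of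
      later terms at \<open>b\<close>; \<open>q b + 1\<close> avoids a division by 0.\<close>
    define c' where "c' = min (snd t / 2) (1 / (2 * (q b + 1)))"
    have qb: "q b \<ge> 0" by (rule q)
    have c': "c' > 0" "2 * c' \<le> snd t" using c qb by (auto simp: c'_def)
    have "c' * (2 * (q b + 1)) \<le> 1 / (2 * (q b + 1)) * (2 * (q b + 1))"
      using qb by (intro mult_right_mono) (auto simp: c'_def)
    then have c'q: "2 * c' * q b \<le> 1" using qb c'(1) by (simp add: algebra_simps)
    have "real n + 2 \<le> cmod (pairing (fst t + scaleF (of_real (snd t)) w) b)"
    proof -
      have "p (fst t) + real n + 2 \<le> snd t * cmod (pairing w b)"
        using w(3) c by (simp add: field_simps)
      moreover have "cmod (pairing (fst t) b) \<le> p (fst t)" using p w by blast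
      moreover have "snd t * cmod (pairing w b) \<le>
          cmod (pairing (fst t + scaleF (of_real (snd t)) w) b) + cmod (pairing (fst t) b)"
        using norm_triangle_ineq4[of "pairing (fst t + scaleF (of_real (snd t)) w) b" "pairing (fst t) b"] c
        by (simp add: pairing_add_left pairing_scale_left norm_mult)
      ultimately show ?thesis by linarith
    qed
    then have "Q n t (fst t + scaleF (of_real (snd t)) w, c')"
      unfolding Q_def using w c' c'q by auto
    moreover have "P (Suc n) (fst t + scaleF (of_real (snd t)) w, c')" using c' by (simp add: P_def)
    ultimately show "\<exists>t'. P (Suc n) t' \<and> Q n t t'" by blast
  qed
  then obtain g where g: "\<And>n. P n (g n)" "\<And>n. Q n (g n) (g (Suc n))" by blast
  define s c where "s = (\<lambda>n. fst (g n))" and "c = (\<lambda>n. snd (g n))"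
  have c0: "c n > 0" for n using g(1)[of n] by (simp add: P_def c_def)
  have half: "2 * c (Suc n) \<le> c n" for n using g(2)[of n] by (simp add: Q_def c_def)
  have step: "cmod (pairing (s (Suc n)) x - pairing (s n) x) \<le> c n * q x" for n x
  proof -
    obtain w where "w \<in> S" "s (Suc n) = s n + scaleF (of_real (c n)) w"
      using g(2)[of n] unfolding Q_def s_def c_def by blast
    then show ?thesis
      using q(2)[of w x] c0[of n] by (simp add: pairing_add_left pairing_scale_left norm_mult)
  qed
  \<comment> \<open>Halving gives \<open>c k \<le> 2 * (c k - c (Suc k))\<close>, so the sum of the
    increments telescopes.\<close>
  have tail: "cmod (pairing (s (n + k)) x - pairing (s n) x) \<le> 2 * (c n - c (n + k)) * q x" for n k x
  proof (induction k)
    case (Suc k)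
    have "c (n + k) \<le> 2 * (c (n + k) - c (n + Suc k))" using half[of "n + k"] by simp
    then have "c (n + k) * q x \<le> 2 * (c (n + k) - c (n + Suc k)) * q x"
      using q(1) by (intro mult_right_mono) auto
    then show ?case
      using Suc step[of "n + k" x]
        norm_triangle_ineq[of "pairing (s (n + Suc k)) x - pairing (s (n + k)) x"
          "pairing (s (n + k)) x - pairing (s n) x"]
      by (simp add: algebra_simps)
  qed simp
  have tail': "cmod (pairing (s m) x - pairing (s n) x) \<le> 2 * c n * q x" if "n \<le> m" for m n x
  proof -
    have "2 * (c n - c m) * q x \<le> 2 * c n * q x"
      using c0[of m] q(1)[of x] by (intro mult_right_mono) auto
    then show ?thesis using tail[of n "m - n" x] that by simp
  qed
  have cle: "c n \<le> c 0 * (1/2) ^ n" for n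
  proof (induction n)
    case (Suc n)
    then show ?case using half[of n] by simp
  qed simp
  have c_lim: "c \<longlonglongrightarrow> 0"
  proof (rule tendsto_sandwich[of "\<lambda>_. 0" c sequentially "\<lambda>n. c 0 * (1/2) ^ n"])
    show "(\<lambda>n. c 0 * (1/2) ^ n) \<longlonglongrightarrow> 0"
      by (intro tendsto_mult_right_zero LIMSEQ_power_zero) simp
  qed (use cle c0 in \<open>auto intro!: always_eventually less_imp_le\<close>)
  have "Cauchy (\<lambda>n. pairing (s n) x)" for x
  proof (rule CauchyI')
    fix e :: real assume "e > 0"
    have "(\<lambda>n. 2 * c n * q x) \<longlonglongrightarrow> 2 * 0 * q x" using c_lim by (intro tendsto_intros)
    then have "\<forall>\<^sub>F n in sequentially. 2 * c n * q x < e"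
      using \<open>e > 0\<close> by (intro order_tendstoD(2)[of _ "2 * 0 * q x"]) auto
    then obtain N where N: "\<And>n. n \<ge> N \<Longrightarrow> 2 * c n * q x < e" by (auto simp: eventually_sequentially)
    have "dist (pairing (s m) x) (pairing (s n) x) < e" if "m \<ge> N" "n > m" for m n
      using tail'[of m n x] N[of m] that by (simp add: dist_norm norm_minus_commute)
    then show "\<exists>M. \<forall>m\<ge>M. \<forall>n>m. dist (pairing (s m) x) (pairing (s n) x) < e" by blast
  qed
  then obtain f where f: "\<And>x. (\<lambda>n. pairing (s n) x) \<longlonglongrightarrow> pairing f x"
    using weak_star_limit[OF complete, of s] by blast
  \<comment> \<open>The step from \<open>n\<close> to \<open>Suc n\<close> produced the value
    \<open>n + 2\<close> at \<open>b\<close>, and the tail after \<open>Suc n\<close> costs at most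
    1. Hence \<open>f\<close> is unbounded on \<open>B\<close>, against the weak boundedness of
    \<open>B\<close>.\<close>
  have large: "\<exists>b\<in>B. real n + 1 \<le> cmod (pairing f b)" for n
  proof -
    obtain b where b: "b \<in> B" "real n + 2 \<le> cmod (pairing (s (Suc n)) b)" "2 * c (Suc n) * q b \<le> 1"
      using g(2)[of n] unfolding Q_def s_def c_def by blast
    have "(\<lambda>m. cmod (pairing (s m) b - pairing (s (Suc n)) b)) \<longlonglongrightarrow>
        cmod (pairing f b - pairing (s (Suc n)) b)"
      by (intro tendsto_intros f)
    moreover have "\<forall>\<^sub>F m in sequentially. cmod (pairing (s m) b - pairing (s (Suc n)) b) \<le> 1"
      using eventually_ge_at_top[of "Suc n"]
    proof eventually_elim
      case (elim m)
      then show ?case using tail'[of "Suc n" m b] b(3) by linarith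
    qed
    ultimately have "cmod (pairing f b - pairing (s (Suc n)) b) \<le> 1"
      by (intro tendsto_upperbound) auto
    then show ?thesis
      using b norm_triangle_ineq3[of "pairing f b" "pairing (s (Suc n)) b"] by force
  qed
  obtain n where "p f < real n" using reals_Archimedean2 by blast
  with large[of n] p[of _ f] show False by force
qed

lemma weak_star_bounded_imp_strong_bounded:
  assumes "weak_star_sequentially_complete pairing"
    and "vs_bounded scaleF (weak_star_topology pairing) S"
  shows "vs_bounded scaleF (strong_topology scaleE pairing) S"
proof (rule vs_bounded_strongI)
  fix B assume "vs_bounded scaleE (weak_topology pairing) B"
  then have "\<exists>C. \<forall>x\<in>B. cmod (pairing f x) \<le> C" for f by (simp add: vs_bounded_weak_iff)
  moreover have "\<exists>C. \<forall>f\<in>S. cmod (pairing f x) \<le> C" for x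
    using assms(2) by (simp add: vs_bounded_weak_star_iff)
  ultimately show "\<exists>C. \<forall>f\<in>S. \<forall>x\<in>B. cmod (pairing f x) \<le> C"
    by (intro weak_star_bounded_imp_uniformly_bounded[OF assms(1)])
qed

section \<open>Positive operators\<close>

lemma linear_operatorD:
  assumes "linear_operator scaleE scaleF D A"
  shows "E.subspace D" "x \<in> D \<Longrightarrow> y \<in> D \<Longrightarrow> A (x + y) = A x + A y"
    "x \<in> D \<Longrightarrow> A (scaleE c x) = scaleF c (A x)"
  using assms by (auto simp: linear_operator_def)

lemma pairing_quadratic_expand:
  assumes A: "linear_operator scaleE scaleF D A" and "x \<in> D" "y \<in> D"
  shows "pairing (A (y + scaleE c x)) (y + scaleE c x) = pairing (A y) y +
    c * pairing (A x) y + cnj c * pairing (A y) x + c * cnj c * pairing (A x) x"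
proof -
  have "scaleE c x \<in> D" using linear_operatorD(1)[OF A] assms by (simp add: E.subspace_scale)
  then show ?thesis
    using assms by (simp add: linear_operatorD[OF A] pairing_add_left pairing_add_right
        pairing_scale_left pairing_scale_right algebra_simps)
qed

text \<open>Polarisation: the form is real at \<open>y + scaleE c x\<close>, so the imaginary part
  of the cross terms vanishes. Taking \<open>c = 1\<close> compares imaginary parts, taking
  \<open>c = \<i>\<close> compares real parts.\<close>

lemma positive_operator_hermitian:
  assumes A: "linear_operator scaleE scaleF D A" and pos: "positive_operator pairing D A"
    and x: "x \<in> D" and y: "y \<in> D"
  shows "pairing (A y) x = cnj (pairing (A x) y)"
proof -
  have im: "Im (pairing (A z) z) = 0" if "z \<in> D" for z
    using pos that by (auto simp: positive_operator_def less_eq_complex_def)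
  have D: "y + scaleE c x \<in> D" for c
    using linear_operatorD(1)[OF A] x y by (simp add: E.subspace_scale E.subspace_add)
  have "Im (c * pairing (A x) y + cnj c * pairing (A y) x) = 0" for c
    using im[OF D[of c]] im[OF x] im[OF y]
    unfolding pairing_quadratic_expand[OF A x y] by (simp add: algebra_simps)
  from this[of 1] this[of \<i>] show ?thesis by (simp add: complex_eq_iff)
qed

text \<open>The form at \<open>y + scaleE c x\<close> is a nonnegative quadratic polynomial in
  \<open>c\<close>, to which the discriminant bound applies.\<close>

lemma positive_operator_Cauchy_Schwarz:
  assumes A: "linear_operator scaleE scaleF D A" and pos: "positive_operator pairing D A"
    and x: "x \<in> D" and y: "y \<in> D"
  shows "(cmod (pairing (A x) y))\<^sup>2 \<le> Re (pairing (A x) x) * Re (pairing (A y) y)"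
proof (rule quadratic_nonneg_imp)
  show "0 \<le> Re (pairing (A x) x)" using pos x by (auto simp: positive_operator_def less_eq_complex_def)
  fix c
  have "y + scaleE c x \<in> D"
    using linear_operatorD(1)[OF A] x y by (simp add: E.subspace_scale E.subspace_add)
  then have "0 \<le> Re (pairing (A (y + scaleE c x)) (y + scaleE c x))"
    using pos by (auto simp: positive_operator_def less_eq_complex_def)
  also have "\<dots> = (cmod c)\<^sup>2 * Re (pairing (A x) x) + 2 * Re (c * pairing (A x) y) + Re (pairing (A y) y)"
    unfolding pairing_quadratic_expand[OF A x y] positive_operator_hermitian[OF A pos x y]
    by (simp add: cmod_power2) (simp add: power2_eq_square algebra_simps)
  finally show "0 \<le> \<dots>" .
qed

text \<open>A Hellinger--Toeplitz effect: by Hermitian symmetry \<open>pairing (T x) z\<close> is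
  the conjugate of \<open>pairing (T z) x\<close>, which is weakly continuous in
  \<open>x\<close>.\<close>

lemma positive_operator_continuous:
  assumes T: "linear_operator scaleE scaleF UNIV T" and pos: "positive_operator pairing UNIV T"
  shows "T \<in> continuous_operators scaleE scaleF pairing"
proof -
  let ?X = "weak_topology pairing"
  have top: "topspace ?X = UNIV" "topspace (weak_star_topology pairing) = UNIV"
    unfolding weak_topology_def weak_star_topology_def by (simp_all add: topspace_initial_topology)
  have cont: "continuous_map ?X euclidean (\<lambda>x. pairing (T x) z)" for z
  proof -
    have "(\<lambda>x. pairing (T x) z) = (\<lambda>x. cnj (pairing (T z) x))"
      using positive_operator_hermitian[OF T pos, of z] by auto
    moreover have "continuous_map ?X euclidean (\<lambda>x. pairing (T z) x)"
      unfolding weak_topology_def by (rule continuous_map_initial_topology) blast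
    moreover have "continuous_map euclidean euclidean cnj"
      by (simp add: continuous_on_cnj)
    ultimately show ?thesis using continuous_map_compose[of ?X euclidean _ euclidean cnj]
      by (simp add: o_def)
  qed
  have "continuous_map ?X (weak_star_topology pairing) T"
    unfolding weak_star_topology_def initial_topology_def
  proof (rule continuous_on_generated_topo)
    fix U assume "U \<in> {\<phi> -` U |\<phi> U. \<phi> \<in> range (\<lambda>x f. pairing f x) \<and> open U}"
    then obtain z V where U: "U = (\<lambda>f. pairing f z) -` V" "open V" by blast
    have "openin ?X {x \<in> topspace ?X. pairing (T x) z \<in> V}"
      by (rule openin_continuous_map_preimage[OF cont]) (simp add: U)
    moreover have "{x \<in> topspace ?X. pairing (T x) z \<in> V} = T -` U \<inter> topspace ?X" using U by auto
    ultimately show "openin ?X (T -` U \<inter> topspace ?X)" by simp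
  next
    show "T ` topspace ?X \<subseteq> \<Union> {\<phi> -` U |\<phi> U. \<phi> \<in> range (\<lambda>x f. pairing f x) \<and> open U}"
      using open_UNIV by blast
  qed
  then show ?thesis using T by (simp add: continuous_operators_def)
qed

definition form_norm :: "('e \<Rightarrow> 'f) \<Rightarrow> 'e \<Rightarrow> real" where
  "form_norm A x = sqrt (Re (pairing (A x) x))"

end

section \<open>The Krein--von Neumann extension\<close>

text \<open>The bound is condition (iv) after taking square roots: each functional given by
  \<open>y\<close> is bounded for the form seminorm. \<open>dominated_operatorI\<close> derives the
  positivity assumption from (iv) as well.\<close>

locale dominated_operator = anti_dual_pair scaleE scaleF pairing
  for scaleE :: "complex \<Rightarrow> 'e::ab_group_add \<Rightarrow> 'e"
    and scaleF :: "complex \<Rightarrow> 'f::ab_group_add \<Rightarrow> 'f"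
    and pairing :: "'f \<Rightarrow> 'e \<Rightarrow> complex" +
  fixes D :: "'e set" and A :: "'e \<Rightarrow> 'f"
  assumes complete: "weak_star_sequentially_complete pairing"
    and linear: "linear_operator scaleE scaleF D A"
    and positive: "positive_operator pairing D A"
    and dominated: "\<exists>M\<ge>0. \<forall>x\<in>D. cmod (pairing (A x) y) \<le> M * form_norm A x"
begin

lemma D_closed:
  "0 \<in> D" "x \<in> D \<Longrightarrow> y \<in> D \<Longrightarrow> x + y \<in> D" "x \<in> D \<Longrightarrow> y \<in> D \<Longrightarrow> x - y \<in> D"
  "x \<in> D \<Longrightarrow> scaleE c x \<in> D"
  using linear_operatorD(1)[OF linear]
  by (auto intro: E.subspace_0 E.subspace_add E.subspace_diff E.subspace_scale)

lemmas A_add = linear_operatorD(2)[OF linear]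
lemmas A_scale = linear_operatorD(3)[OF linear]

lemma A_diff: "x \<in> D \<Longrightarrow> y \<in> D \<Longrightarrow> A (x - y) = A x - A y"
  using A_add[of "x - y" y] D_closed by (simp add: eq_diff_eq)

lemma form_nonneg: "x \<in> D \<Longrightarrow> 0 \<le> Re (pairing (A x) x)"
  using positive by (auto simp: positive_operator_def less_eq_complex_def)

lemma form_norm_nonneg: "x \<in> D \<Longrightarrow> 0 \<le> form_norm A x"
  by (simp add: form_norm_def form_nonneg)

lemma pairing_form_norm: "x \<in> D \<Longrightarrow> pairing (A x) x = of_real ((form_norm A x)\<^sup>2)"
  using positive form_nonneg[of x]
  by (auto simp: form_norm_def positive_operator_def less_eq_complex_def complex_eq_iff)

text \<open>
  In the completion of \<open>D\<close> under the form \<open>\<langle>Ax,x\<rangle>\<close>, the functional \<open>x \<mapsto> \<langle>Ax,y\<rangle>\<close> is represented by a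
  vector; the \<open>v\<close> found here approximate it.  They nearly minimise \<open>\<langle>Ax,x\<rangle> - 2 Re \<langle>Ax,y\<rangle>\<close>.
\<close>

lemma approximate_representation:
  assumes "e > 0"
  obtains v where "v \<in> D" "\<And>x. x \<in> D \<Longrightarrow> cmod (pairing (A x) (y - v)) \<le> e * form_norm A x"
proof -
  define \<phi> where "\<phi> x = Re (pairing (A x) x) - 2 * Re (pairing (A x) y)" for x
  obtain M where M: "M \<ge> 0" "\<And>x. x \<in> D \<Longrightarrow> cmod (pairing (A x) y) \<le> M * form_norm A x"
    using dominated by blast
  \<comment> \<open>Completing the square: with \<open>r = form_norm A x\<close> one has
    \<open>\<phi> x \<ge> r\<^sup>2 - 2 * M * r\<close>.\<close>
  have "- M\<^sup>2 \<le> \<phi> x" if "x \<in> D" for x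
  proof -
    have "Re (pairing (A x) y) \<le> M * form_norm A x"
      using M(2)[OF that] complex_Re_le_cmod order_trans by blast
    moreover have "0 \<le> (form_norm A x - M)\<^sup>2" by simp
    ultimately show ?thesis
      by (simp add: \<phi>_def pairing_form_norm[OF that] power2_diff algebra_simps)
  qed
  then have bdd: "bdd_below (\<phi> ` D)" by (rule bdd_belowI2)
  \<comment> \<open>The tolerance is the square of \<open>e\<close> because the discriminant bound
    below controls the square of the pairing.\<close>
  have "\<exists>v\<in>D. \<phi> v < Inf (\<phi> ` D) + e\<^sup>2"
    using cInf_lessD[of "\<phi> ` D" "Inf (\<phi> ` D) + e\<^sup>2"] D_closed(1) assms by auto
  then obtain v where v: "v \<in> D" "\<phi> v < Inf (\<phi> ` D) + e\<^sup>2" by blast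
  have "cmod (pairing (A x) (y - v)) \<le> e * form_norm A x" if x: "x \<in> D" for x
  proof -
    \<comment> \<open>Moving from \<open>v\<close> to \<open>v + scaleE c x\<close> lowers
      \<open>\<phi>\<close> by at most the tolerance, and the change is a quadratic polynomial in
      \<open>c\<close> whose linear coefficient is the quantity to be estimated.\<close>
    have "(cmod (- pairing (A x) (y - v)))\<^sup>2 \<le> Re (pairing (A x) x) * e\<^sup>2"
    proof (rule quadratic_nonneg_imp)
      show "0 \<le> Re (pairing (A x) x)" using form_nonneg x .
      fix c
      have "Inf (\<phi> ` D) \<le> \<phi> (v + scaleE c x)"
        using bdd v x D_closed by (intro cInf_lower) auto
      then have "0 \<le> \<phi> (v + scaleE c x) - \<phi> v + e\<^sup>2" using v(2) by simp
      also have "\<phi> (v + scaleE c x) - \<phi> v =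
          (cmod c)\<^sup>2 * Re (pairing (A x) x) + 2 * Re (c * - pairing (A x) (y - v))"
        unfolding \<phi>_def pairing_quadratic_expand[OF linear x v(1)]
          positive_operator_hermitian[OF linear positive x v(1)] cmod_power2
        using v(1) x D_closed(4)[OF x, of c]
        by (simp add: A_add A_scale pairing_add_left pairing_scale_left pairing_diff_right)
          (simp add: power2_eq_square algebra_simps)
      finally show "0 \<le> (cmod c)\<^sup>2 * Re (pairing (A x) x) +
          2 * Re (c * - pairing (A x) (y - v)) + e\<^sup>2" .
    qed
    also have "\<dots> = (e * form_norm A x)\<^sup>2"
      by (simp add: pairing_form_norm[OF x] power_mult_distrib)
    finally show ?thesis
      using assms form_norm_nonneg[OF x] by (simp add: power2_le_iff_abs_le)
  qed
  with v(1) that show thesis by blast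
qed

section \<open>Approximating sequences and the graph of the extension\<close>

text \<open>Convergence of the functionals in the dual seminorm, with an explicit error sequence so
  that errors can be added and scaled. No sign is imposed on \<open>\<delta>\<close>, hence the
  absolute values in the estimates below.\<close>

definition approximates :: "(nat \<Rightarrow> 'e) \<Rightarrow> (nat \<Rightarrow> real) \<Rightarrow> 'e \<Rightarrow> bool" where
  "approximates v \<delta> y \<longleftrightarrow> (\<forall>n. v n \<in> D) \<and> \<delta> \<longlonglongrightarrow> 0 \<and>
     (\<forall>n. \<forall>x\<in>D. cmod (pairing (A x) (y - v n)) \<le> \<delta> n * form_norm A x)"

text \<open>A relation at first, since the limit might depend on the chosen sequence;
  \<open>KvN_graph_unique\<close> excludes this.\<close>

definition KvN_graph :: "'e \<Rightarrow> 'f \<Rightarrow> bool" where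
  "KvN_graph y f \<longleftrightarrow> (\<exists>v \<delta>. approximates v \<delta> y \<and>
     (\<forall>z. (\<lambda>n. pairing (A (v n)) z) \<longlonglongrightarrow> pairing f z))"

text \<open>The pairing on the left is the square of the seminorm, so one factor cancels. This turns
  a functional estimate tested at \<open>x\<close> itself into a bound on the seminorm of
  \<open>x\<close>.\<close>

lemma form_norm_le:
  assumes x: "x \<in> D" and le: "cmod (pairing (A x) x) \<le> M * form_norm A x" and "M \<ge> 0"
  shows "form_norm A x \<le> M"
proof (cases "form_norm A x = 0")
  case False
  then have "form_norm A x > 0" using form_norm_nonneg[OF x] by simp
  moreover have "form_norm A x * form_norm A x \<le> M * form_norm A x"
    using le by (simp add: pairing_form_norm[OF x] power2_eq_square norm_mult)
  ultimately show ?thesis by simp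
qed (use assms in simp)

lemma approximates_ex: "\<exists>v \<delta>. approximates v \<delta> y"
proof -
  have "\<forall>n. \<exists>v. v \<in> D \<and> (\<forall>x\<in>D. cmod (pairing (A x) (y - v)) \<le> inverse (real (Suc n)) * form_norm A x)"
    using approximate_representation[of "inverse (real (Suc _))" y]
    by (metis inverse_positive_iff_positive of_nat_0_less_iff zero_less_Suc)
  then obtain v where "\<forall>n. v n \<in> D \<and>
      (\<forall>x\<in>D. cmod (pairing (A x) (y - v n)) \<le> inverse (real (Suc n)) * form_norm A x)" by metis
  then have "approximates v (\<lambda>n. inverse (real (Suc n))) y"
    unfolding approximates_def using LIMSEQ_inverse_real_of_nat by blast
  then show ?thesis by blast
qed

text \<open>Both error estimates are tested at \<open>v m - v n\<close>, which is itself the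
  difference of \<open>y - v n\<close> and \<open>y - v m\<close>. Hence \<open>v\<close> is Cauchy
  for the form seminorm.\<close>

lemma approximates_form_norm_diff:
  assumes "approximates v \<delta> y"
  shows "form_norm A (v m - v n) \<le> \<bar>\<delta> m\<bar> + \<bar>\<delta> n\<bar>"
proof (rule form_norm_le)
  let ?x = "v m - v n"
  show x: "?x \<in> D" using assms D_closed by (auto simp: approximates_def)
  have "cmod (pairing (A ?x) (y - v k)) \<le> \<bar>\<delta> k\<bar> * form_norm A ?x" for k
  proof -
    have "cmod (pairing (A ?x) (y - v k)) \<le> \<delta> k * form_norm A ?x"
      using assms x by (auto simp: approximates_def)
    also have "\<dots> \<le> \<bar>\<delta> k\<bar> * form_norm A ?x"
      using form_norm_nonneg[OF x] by (intro mult_right_mono) auto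
    finally show ?thesis .
  qed
  from this[of m] this[of n]
  show "cmod (pairing (A ?x) ?x) \<le> (\<bar>\<delta> m\<bar> + \<bar>\<delta> n\<bar>) * form_norm A ?x"
    using norm_triangle_ineq4[of "pairing (A ?x) (y - v n)" "pairing (A ?x) (y - v m)"]
    by (simp add: pairing_diff_right algebra_simps)
qed auto

text \<open>Domination turns the Cauchy property for the seminorm into pointwise Cauchy sequences
  \<open>pairing (A (v n)) z\<close>, and completeness supplies the limit in
  \<open>F\<close>.\<close>

lemma KvN_graph_ex: "\<exists>f. KvN_graph y f"
proof -
  obtain v \<delta> where v: "approximates v \<delta> y" using approximates_ex by blast
  then have D: "v n \<in> D" for n by (simp add: approximates_def)
  have \<delta>: "\<delta> \<longlonglongrightarrow> 0" using v by (simp add: approximates_def)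
  have "Cauchy (\<lambda>n. pairing (A (v n)) z)" for z
  proof (rule CauchyI)
    fix e :: real assume e: "e > 0"
    obtain M where M: "M \<ge> 0" "\<And>x. x \<in> D \<Longrightarrow> cmod (pairing (A x) z) \<le> M * form_norm A x"
      using dominated by blast
    have "(\<lambda>n. M * \<bar>\<delta> n\<bar>) \<longlonglongrightarrow> M * \<bar>0\<bar>" by (intro tendsto_intros \<delta>)
    then have "\<forall>\<^sub>F n in sequentially. M * \<bar>\<delta> n\<bar> < e / 2"
      using e by (intro order_tendstoD(2)[of _ "M * \<bar>0\<bar>"]) auto
    then obtain N where N: "\<And>n. n \<ge> N \<Longrightarrow> M * \<bar>\<delta> n\<bar> < e / 2"
      by (auto simp: eventually_sequentially)
    have "norm (pairing (A (v m)) z - pairing (A (v n)) z) < e" if "m \<ge> N" "n \<ge> N" for m n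
    proof -
      have "norm (pairing (A (v m)) z - pairing (A (v n)) z) \<le> M * form_norm A (v m - v n)"
        using M(2)[of "v m - v n"] D by (simp add: D_closed A_diff pairing_diff_left)
      also have "\<dots> \<le> M * (\<bar>\<delta> m\<bar> + \<bar>\<delta> n\<bar>)"
        using M(1) approximates_form_norm_diff[OF v] by (rule mult_left_mono[rotated])
      also have "\<dots> < e" using N[OF that(1)] N[OF that(2)] by (simp add: algebra_simps)
      finally show ?thesis .
    qed
    then show "\<exists>M. \<forall>m\<ge>M. \<forall>n\<ge>M. norm (pairing (A (v m)) z - pairing (A (v n)) z) < e" by blast
  qed
  then show ?thesis
    using weak_star_limit[OF complete, of "\<lambda>n. A (v n)"] v unfolding KvN_graph_def by metis
qed

lemma KvN_graph_add:
  assumes "KvN_graph y f" "KvN_graph y' f'"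
  shows "KvN_graph (y + y') (f + f')"
proof -
  obtain v \<delta> where v: "approximates v \<delta> y" "\<And>z. (\<lambda>n. pairing (A (v n)) z) \<longlonglongrightarrow> pairing f z"
    using assms(1) unfolding KvN_graph_def by blast
  obtain w \<epsilon> where w: "approximates w \<epsilon> y'" "\<And>z. (\<lambda>n. pairing (A (w n)) z) \<longlonglongrightarrow> pairing f' z"
    using assms(2) unfolding KvN_graph_def by blast
  have D: "v n \<in> D" "w n \<in> D" for n using v w by (auto simp: approximates_def)
  have "cmod (pairing (A x) (y + y' - (v n + w n))) \<le> (\<delta> n + \<epsilon> n) * form_norm A x" if "x \<in> D" for x n
  proof -
    have "cmod (pairing (A x) (y - v n)) \<le> \<delta> n * form_norm A x"
      "cmod (pairing (A x) (y' - w n)) \<le> \<epsilon> n * form_norm A x"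
      using v(1) w(1) that by (auto simp: approximates_def)
    moreover have "pairing (A x) (y + y' - (v n + w n)) = pairing (A x) (y - v n) + pairing (A x) (y' - w n)"
      by (simp add: pairing_diff_right pairing_add_right)
    ultimately show ?thesis
      using norm_triangle_ineq[of "pairing (A x) (y - v n)" "pairing (A x) (y' - w n)"]
      by (simp add: algebra_simps)
  qed
  moreover have "(\<lambda>n. \<delta> n + \<epsilon> n) \<longlonglongrightarrow> 0"
    using v(1) w(1) tendsto_add[of \<delta> 0 sequentially \<epsilon> 0] by (simp add: approximates_def)
  ultimately have "approximates (\<lambda>n. v n + w n) (\<lambda>n. \<delta> n + \<epsilon> n) (y + y')"
    using D D_closed by (simp add: approximates_def)
  moreover have "(\<lambda>n. pairing (A (v n + w n)) z) \<longlonglongrightarrow> pairing (f + f') z" for z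
    using tendsto_add[OF v(2) w(2), of z z] D by (simp add: A_add pairing_add_left)
  ultimately show ?thesis unfolding KvN_graph_def by blast
qed

lemma KvN_graph_scale:
  assumes "KvN_graph y f"
  shows "KvN_graph (scaleE c y) (scaleF c f)"
proof -
  obtain v \<delta> where v: "approximates v \<delta> y" "\<And>z. (\<lambda>n. pairing (A (v n)) z) \<longlonglongrightarrow> pairing f z"
    using assms(1) unfolding KvN_graph_def by blast
  have D: "v n \<in> D" for n using v by (auto simp: approximates_def)
  have "cmod (pairing (A x) (scaleE c y - scaleE c (v n))) \<le> cmod c * \<delta> n * form_norm A x"
    if "x \<in> D" for x n
  proof -
    have "cmod c * cmod (pairing (A x) (y - v n)) \<le> cmod c * (\<delta> n * form_norm A x)"
      using v(1) that by (intro mult_left_mono) (auto simp: approximates_def)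
    then show ?thesis
      by (simp add: pairing_scale_right norm_mult mult.assoc flip: E.scale_right_diff_distrib)
  qed
  moreover have "(\<lambda>n. cmod c * \<delta> n) \<longlonglongrightarrow> 0"
    using v(1) by (intro tendsto_mult_right_zero) (simp add: approximates_def)
  ultimately have "approximates (\<lambda>n. scaleE c (v n)) (\<lambda>n. cmod c * \<delta> n) (scaleE c y)"
    using D D_closed by (simp add: approximates_def)
  moreover have "(\<lambda>n. pairing (A (scaleE c (v n))) z) \<longlonglongrightarrow> pairing (scaleF c f) z" for z
    using tendsto_mult_left[OF v(2), of c z] D by (simp add: A_scale pairing_scale_left)
  ultimately show ?thesis unfolding KvN_graph_def by blast
qed

lemma KvN_graph_self:
  assumes "y \<in> D"
  shows "KvN_graph y (A y)"
  unfolding KvN_graph_def approximates_def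
  by (rule exI[of _ "\<lambda>_. y"], rule exI[of _ "\<lambda>_. 0"]) (simp add: assms)

text \<open>The form at \<open>v n\<close> differs from \<open>pairing (A (v n)) y\<close> by a term
  of size at most \<open>\<bar>\<delta> n\<bar> * form_norm A (v n)\<close>, which tends to 0
  because the seminorms stay bounded. Uniqueness, positivity and minimality are all read off from
  this limit.\<close>

lemma KvN_graph_form_limit:
  assumes "KvN_graph y f"
  obtains v where "\<And>n. v n \<in> D" "\<And>z. (\<lambda>n. pairing (A (v n)) z) \<longlonglongrightarrow> pairing f z"
    "(\<lambda>n. pairing (A (v n)) (v n)) \<longlonglongrightarrow> pairing f y"
proof -
  obtain v \<delta> where v: "approximates v \<delta> y" and lim: "\<And>z. (\<lambda>n. pairing (A (v n)) z) \<longlonglongrightarrow> pairing f z"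
    using assms(1) unfolding KvN_graph_def by blast
  have D: "v n \<in> D" for n using v by (auto simp: approximates_def)
  have \<delta>: "\<delta> \<longlonglongrightarrow> 0" using v by (simp add: approximates_def)
  have app: "cmod (pairing (A (v n)) (y - v n)) \<le> \<bar>\<delta> n\<bar> * form_norm A (v n)" for n
  proof -
    have "cmod (pairing (A (v n)) (y - v n)) \<le> \<delta> n * form_norm A (v n)"
      using v D by (auto simp: approximates_def)
    also have "\<dots> \<le> \<bar>\<delta> n\<bar> * form_norm A (v n)"
      using form_norm_nonneg[OF D] by (intro mult_right_mono) auto
    finally show ?thesis .
  qed
  obtain M where M: "M \<ge> 0" "\<And>x. x \<in> D \<Longrightarrow> cmod (pairing (A x) y) \<le> M * form_norm A x"
    using dominated by blast
  have bound: "form_norm A (v n) \<le> M + \<bar>\<delta> n\<bar>" for n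
  proof (rule form_norm_le)
    show "cmod (pairing (A (v n)) (v n)) \<le> (M + \<bar>\<delta> n\<bar>) * form_norm A (v n)"
      using M(2)[OF D, of n] app[of n]
        norm_triangle_ineq4[of "pairing (A (v n)) y" "pairing (A (v n)) (y - v n)"]
      by (simp add: pairing_diff_right algebra_simps)
  qed (use D M in auto)
  have "(\<lambda>n. pairing (A (v n)) (y - v n)) \<longlonglongrightarrow> 0"
  proof (rule Lim_null_comparison)
    show "\<forall>\<^sub>F n in sequentially. norm (pairing (A (v n)) (y - v n)) \<le> \<bar>\<delta> n\<bar> * (M + \<bar>\<delta> n\<bar>)"
      using app bound by (intro always_eventually allI) (meson abs_ge_zero mult_left_mono order_trans)
    have "(\<lambda>n. \<bar>\<delta> n\<bar> * (M + \<bar>\<delta> n\<bar>)) \<longlonglongrightarrow> \<bar>0\<bar> * (M + \<bar>0\<bar>)" by (intro tendsto_intros \<delta>)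
    then show "(\<lambda>n. \<bar>\<delta> n\<bar> * (M + \<bar>\<delta> n\<bar>)) \<longlonglongrightarrow> 0" by simp
  qed
  from tendsto_diff[OF lim[of y] this]
  have "(\<lambda>n. pairing (A (v n)) (v n)) \<longlonglongrightarrow> pairing f y" by (simp add: pairing_diff_right)
  then show thesis using that D lim by blast
qed

text \<open>By linearity \<open>f - g\<close> is a value at 0, so the form along its approximating
  sequence tends to 0. Domination then forces every pairing with \<open>f - g\<close> to
  vanish.\<close>

lemma KvN_graph_unique:
  assumes "KvN_graph y f" "KvN_graph y g"
  shows "f = g"
proof -
  have "KvN_graph 0 (f - g)"
    using KvN_graph_add[OF assms(1) KvN_graph_scale[OF assms(2), of "-1"]] by simp
  then obtain v where D: "\<And>n. v n \<in> D"
    and lim: "\<And>z. (\<lambda>n. pairing (A (v n)) z) \<longlonglongrightarrow> pairing (f - g) z"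
    and lim0: "(\<lambda>n. pairing (A (v n)) (v n)) \<longlonglongrightarrow> pairing (f - g) 0"
    by (rule KvN_graph_form_limit) blast
  have "(\<lambda>n. sqrt (Re (pairing (A (v n)) (v n)))) \<longlonglongrightarrow> sqrt (Re (pairing (f - g) 0))"
    by (intro tendsto_intros lim0)
  then have norm0: "(\<lambda>n. form_norm A (v n)) \<longlonglongrightarrow> 0" by (simp add: form_norm_def)
  have "pairing (f - g) z = 0" for z
  proof -
    obtain M where M: "M \<ge> 0" "\<And>x. x \<in> D \<Longrightarrow> cmod (pairing (A x) z) \<le> M * form_norm A x"
      using dominated by blast
    have "(\<lambda>n. pairing (A (v n)) z) \<longlonglongrightarrow> 0"
    proof (rule Lim_null_comparison)
      show "\<forall>\<^sub>F n in sequentially. norm (pairing (A (v n)) z) \<le> M * form_norm A (v n)"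
        using M(2) D by simp
      show "(\<lambda>n. M * form_norm A (v n)) \<longlonglongrightarrow> 0" using norm0 by (rule tendsto_mult_right_zero)
    qed
    then show ?thesis using lim LIMSEQ_unique by blast
  qed
  then show ?thesis using separates_F[of "f - g"] by simp
qed

section \<open>The extension as a positive operator and its minimality\<close>

definition KvN_extension :: "'e \<Rightarrow> 'f" where
  "KvN_extension y = (THE f. KvN_graph y f)"

lemma KvN_graph_KvN_extension: "KvN_graph y (KvN_extension y)"
  unfolding KvN_extension_def using KvN_graph_ex KvN_graph_unique by (metis theI)

lemma KvN_extension_eqI: "KvN_graph y f \<Longrightarrow> KvN_extension y = f"
  using KvN_graph_KvN_extension KvN_graph_unique by blast

lemma KvN_extension_linear: "linear_operator scaleE scaleF UNIV KvN_extension"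
  unfolding linear_operator_def
  by (auto intro!: KvN_extension_eqI KvN_graph_add KvN_graph_scale KvN_graph_KvN_extension)

lemma KvN_extension_positive: "positive_operator pairing UNIV KvN_extension"
  unfolding positive_operator_def
proof
  fix y
  obtain v where D: "\<And>n. v n \<in> D"
    and lim: "(\<lambda>n. pairing (A (v n)) (v n)) \<longlonglongrightarrow> pairing (KvN_extension y) y"
    by (rule KvN_graph_form_limit[OF KvN_graph_KvN_extension[of y]]) blast
  have "0 \<le> Re (pairing (KvN_extension y) y)"
    using tendsto_Re[OF lim] form_nonneg D by (intro tendsto_lowerbound) (auto intro: always_eventually)
  moreover have "Im (pairing (KvN_extension y) y) = 0"
    using tendsto_Im[OF lim] D by (simp add: pairing_form_norm LIMSEQ_const_iff)
  ultimately show "0 \<le> pairing (KvN_extension y) y" by (simp add: less_eq_complex_def)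
qed

lemma KvN_extension_positive_extension:
  "positive_extension scaleE scaleF pairing D A KvN_extension"
  unfolding positive_extension_def
  using positive_operator_continuous[OF KvN_extension_linear KvN_extension_positive]
    KvN_extension_positive KvN_extension_eqI KvN_graph_self by blast

text \<open>On \<open>D\<close> the operators \<open>T\<close> and \<open>A\<close> agree, so
  Cauchy--Schwarz for \<open>T\<close> can be applied to \<open>v n\<close> and \<open>y\<close>. In
  the limit the square of \<open>?N\<close> is at most \<open>?N\<close> times
  \<open>pairing (T y) y\<close>, and one factor cancels.\<close>

lemma KvN_extension_le:
  assumes "positive_extension scaleE scaleF pairing D A T"
  shows "operator_le pairing KvN_extension T"
  unfolding operator_le_def
proof
  fix y
  have T: "linear_operator scaleE scaleF UNIV T" "positive_operator pairing UNIV T"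
    and ext: "\<And>x. x \<in> D \<Longrightarrow> T x = A x"
    using assms by (auto simp: positive_extension_def continuous_operators_def)
  let ?N = "pairing (KvN_extension y) y"
  obtain v where D: "\<And>n. v n \<in> D"
    and lim: "\<And>z. (\<lambda>n. pairing (A (v n)) z) \<longlonglongrightarrow> pairing (KvN_extension y) z"
    and lim2: "(\<lambda>n. pairing (A (v n)) (v n)) \<longlonglongrightarrow> ?N"
    by (rule KvN_graph_form_limit[OF KvN_graph_KvN_extension[of y]]) blast
  have "(cmod (pairing (A (v n)) y))\<^sup>2 \<le> Re (pairing (A (v n)) (v n)) * Re (pairing (T y) y)" for n
    using positive_operator_Cauchy_Schwarz[OF T, of "v n" y] ext[OF D] by simp
  then have CS: "(cmod ?N)\<^sup>2 \<le> Re ?N * Re (pairing (T y) y)"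
    by (intro tendsto_le[OF _ tendsto_mult_right[OF tendsto_Re[OF lim2]]
          tendsto_power[OF tendsto_norm[OF lim[of y]]]]) auto
  have N: "0 \<le> ?N" "0 \<le> pairing (T y) y"
    using KvN_extension_positive T(2) by (auto simp: positive_operator_def)
  then have "cmod ?N = Re ?N" by (auto simp: less_eq_complex_def cmod_eq_Re)
  with CS have "Re ?N * Re ?N \<le> Re ?N * Re (pairing (T y) y)" by (simp add: power2_eq_square)
  \<comment> \<open>When \<open>?N\<close> vanishes nothing can be cancelled, and positivity of
    \<open>T\<close> gives the claim.\<close>
  then have "Re ?N \<le> Re (pairing (T y) y)"
    using N by (cases "Re ?N = 0") (auto simp: less_eq_complex_def)
  then show "0 \<le> pairing (T y - KvN_extension y) y"
    using N by (auto simp: less_eq_complex_def pairing_diff_left)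
qed

end

section \<open>Equivalence of the conditions\<close>

context anti_dual_pair
begin

text \<open>Scaling \<open>x\<close> by a real \<open>t\<close> multiplies the form by the square of
  \<open>t\<close>. As the form is real, the scaled vector satisfies the constraint in the complex
  order and its image lies in \<open>W_set\<close>.\<close>

lemma real_form_bounded_imp_scaled_le:
  assumes A: "linear_operator scaleE scaleF D A" and real: "real_form pairing D A"
    and bounded: "\<And>f. f \<in> W_set pairing D A \<Longrightarrow> cmod (pairing f y) \<le> C"
    and x: "x \<in> D" and t: "t\<^sup>2 * Re (pairing (A x) x) \<le> 1"
  shows "\<bar>t\<bar> * cmod (pairing (A x) y) \<le> C"
proof -
  have tx: "scaleE (of_real t) x \<in> D" using linear_operatorD(1)[OF A] x by (simp add: E.subspace_scale)
  have "Im (pairing (A x) x) = 0" using real x by (auto simp: real_form_def complex_is_Real_iff)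
  then have "pairing (A (scaleE (of_real t) x)) (scaleE (of_real t) x) \<le> 1"
    using t by (simp add: linear_operatorD(3)[OF A x] pairing_scale_left pairing_scale_right
        less_eq_complex_def power2_eq_square mult.assoc)
  then have "cmod (pairing (A (scaleE (of_real t) x)) y) \<le> C"
    using bounded tx by (auto simp: W_set_def)
  then show ?thesis by (simp add: linear_operatorD(3)[OF A x] pairing_scale_left norm_mult)
qed

text \<open>For a nonpositive form value every real multiple of \<open>x\<close> satisfies the
  constraint, so a bounded set contains all real multiples of \<open>A x\<close>.\<close>

lemma real_form_bounded_imp_eq_0:
  assumes A: "linear_operator scaleE scaleF D A" and real: "real_form pairing D A"
    and bounded: "\<And>f. f \<in> W_set pairing D A \<Longrightarrow> cmod (pairing f y) \<le> C"
    and x: "x \<in> D" and nonpos: "Re (pairing (A x) x) \<le> 0"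
  shows "pairing (A x) y = 0"
proof (rule ccontr)
  assume "pairing (A x) y \<noteq> 0"
  then have pos: "cmod (pairing (A x) y) > 0" by simp
  \<comment> \<open>Chosen so that the scaled pairing has modulus \<open>\<bar>C\<bar> + 1\<close>,
    beyond the bound \<open>C\<close>.\<close>
  define t where "t = (\<bar>C\<bar> + 1) / cmod (pairing (A x) y)"
  have "t\<^sup>2 * Re (pairing (A x) x) \<le> 1"
    using nonpos mult_nonneg_nonpos[of "t\<^sup>2" "Re (pairing (A x) x)"] by simp
  from real_form_bounded_imp_scaled_le[OF A real bounded x this]
  have "\<bar>t\<bar> * cmod (pairing (A x) y) \<le> C" by simp
  moreover have "\<bar>t\<bar> * cmod (pairing (A x) y) = \<bar>C\<bar> + 1" using pos by (simp add: t_def)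
  ultimately show False by linarith
qed

text \<open>If the form is positive at \<open>x\<close>, normalising it to 1 puts the image into
  \<open>W_set\<close>. Otherwise \<open>A x\<close> pairs to 0 with every vector, including
  \<open>x\<close> itself, so both sides vanish and negative form values are excluded.\<close>

lemma real_form_bounded_imp_dominated:
  assumes A: "linear_operator scaleE scaleF D A" and real: "real_form pairing D A"
    and bounded: "\<And>f y. f \<in> W_set pairing D A \<Longrightarrow> cmod (pairing f y) \<le> C y" and x: "x \<in> D"
  shows "complex_of_real ((cmod (pairing (A x) y))\<^sup>2) \<le> complex_of_real ((C y)\<^sup>2) * pairing (A x) x"
proof -
  define a where "a = Re (pairing (A x) x)"
  have a: "pairing (A x) x = of_real a"
    using real x by (auto simp: a_def real_form_def complex_is_Real_iff complex_eq_iff)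
  show ?thesis
  proof (cases "a \<le> 0")
    case True
    then have "pairing (A x) z = 0" for z
      using real_form_bounded_imp_eq_0[OF A real bounded x, of z] by (simp add: a_def)
    then show ?thesis by simp
  next
    case False
    then have "(1 / sqrt a)\<^sup>2 * Re (pairing (A x) x) \<le> 1"
      by (simp add: power_divide flip: a_def)
    from real_form_bounded_imp_scaled_le[OF A real bounded x this, of y]
    have "cmod (pairing (A x) y) \<le> C y * sqrt a" using False by (simp add: field_simps)
    then have "(cmod (pairing (A x) y))\<^sup>2 \<le> (C y * sqrt a)\<^sup>2" by (intro power_mono) auto
    also have "\<dots> = (C y)\<^sup>2 * a" using False by (simp add: power_mult_distrib)
    finally show ?thesis unfolding a by (simp add: less_eq_complex_def)
  qed
qed

text \<open>Taking \<open>y = x\<close> in (iv) gives positivity: the order on complex numbers makes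
  the form real, and a positive \<open>M\<close> can be divided out. For \<open>M = 0\<close> the
  form vanishes at \<open>x\<close>.\<close>

lemma dominated_operatorI:
  assumes complete: "weak_star_sequentially_complete pairing"
    and A: "linear_operator scaleE scaleF D A"
    and dom: "\<forall>y. \<exists>M::real. 0 \<le> M \<and> (\<forall>x\<in>D.
      complex_of_real ((cmod (pairing (A x) y))\<^sup>2) \<le> complex_of_real M * pairing (A x) x)"
  shows "dominated_operator scaleE scaleF pairing D A"
proof
  show "weak_star_sequentially_complete pairing" "linear_operator scaleE scaleF D A" by fact+
  show "positive_operator pairing D A"
    unfolding positive_operator_def
  proof
    fix x assume "x \<in> D"
    with dom obtain M :: real where M: "0 \<le> M"
      "complex_of_real ((cmod (pairing (A x) x))\<^sup>2) \<le> complex_of_real M * pairing (A x) x" by blast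
    show "0 \<le> pairing (A x) x"
    proof (cases "M = 0")
      case False
      with M have "M > 0" by simp
      have "0 \<le> (cmod (pairing (A x) x))\<^sup>2" by simp
      also have "\<dots> \<le> M * Re (pairing (A x) x)" using M(2) by (simp add: less_eq_complex_def)
      finally show ?thesis
        using M(2) \<open>M > 0\<close> by (auto simp: less_eq_complex_def zero_le_mult_iff)
    qed (use M in \<open>simp add: less_eq_complex_def\<close>)
  qed
  fix y
  obtain M where M: "0 \<le> M" "\<And>x. x \<in> D \<Longrightarrow>
      complex_of_real ((cmod (pairing (A x) y))\<^sup>2) \<le> complex_of_real M * pairing (A x) x"
    using dom by blast
  have "cmod (pairing (A x) y) \<le> sqrt M * form_norm A x" if "x \<in> D" for x
  proof -
    have "(cmod (pairing (A x) y))\<^sup>2 \<le> M * Re (pairing (A x) x)"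
      using M(2)[OF that] by (simp add: less_eq_complex_def)
    from real_sqrt_le_mono[OF this] show ?thesis by (simp add: form_norm_def real_sqrt_mult)
  qed
  then show "\<exists>M\<ge>0. \<forall>x\<in>D. cmod (pairing (A x) y) \<le> M * form_norm A x"
    using M(1) by (intro exI[of _ "sqrt M"]) simp
qed

text \<open>Cauchy--Schwarz for the extension, with \<open>Re (pairing (T y) y)\<close> as the
  constant belonging to \<open>y\<close>.\<close>

lemma positive_extension_imp_dominated:
  assumes "positive_extension scaleE scaleF pairing D A T"
  shows "\<exists>M::real. 0 \<le> M \<and> (\<forall>x\<in>D.
    complex_of_real ((cmod (pairing (A x) y))\<^sup>2) \<le> complex_of_real M * pairing (A x) x)"
proof (intro exI conjI ballI)
  have T: "linear_operator scaleE scaleF UNIV T" "positive_operator pairing UNIV T"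
    and ext: "\<And>x. x \<in> D \<Longrightarrow> T x = A x"
    using assms by (auto simp: positive_extension_def continuous_operators_def)
  have pos: "0 \<le> pairing (T x) x" for x using T(2) by (simp add: positive_operator_def)
  show "0 \<le> Re (pairing (T y) y)" using pos[of y] by (simp add: less_eq_complex_def)
  fix x assume "x \<in> D"
  then show "complex_of_real ((cmod (pairing (A x) y))\<^sup>2) \<le>
      complex_of_real (Re (pairing (T y) y)) * pairing (A x) x"
    using positive_operator_Cauchy_Schwarz[OF T, of x y] pos[of x] ext[of x]
    by (simp add: less_eq_complex_def mult.commute)
qed

lemma dominated_imp_weak_star_bounded:
  assumes dom: "\<forall>y. \<exists>M::real. 0 \<le> M \<and> (\<forall>x\<in>D.
      complex_of_real ((cmod (pairing (A x) y))\<^sup>2) \<le> complex_of_real M * pairing (A x) x)"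
  shows "vs_bounded scaleF (weak_star_topology pairing) (W_set pairing D A)"
  unfolding vs_bounded_weak_star_iff
proof
  fix y
  obtain M where M: "0 \<le> M" "\<And>x. x \<in> D \<Longrightarrow>
      complex_of_real ((cmod (pairing (A x) y))\<^sup>2) \<le> complex_of_real M * pairing (A x) x"
    using dom by blast
  have "cmod (pairing (A x) y) \<le> sqrt M" if "x \<in> D" "pairing (A x) x \<le> 1" for x
  proof (rule real_le_rsqrt)
    have "(cmod (pairing (A x) y))\<^sup>2 \<le> M * Re (pairing (A x) x)"
      using M(2)[OF that(1)] by (simp add: less_eq_complex_def)
    also have "\<dots> \<le> M" using M(1) that(2) by (simp add: less_eq_complex_def mult_left_le)
    finally show "(cmod (pairing (A x) y))\<^sup>2 \<le> M" .
  qed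
  then show "\<exists>C. \<forall>f\<in>W_set pairing D A. cmod (pairing f y) \<le> C" by (auto simp: W_set_def)
qed

end

theorem theorem3p1:
  fixes scaleE :: "complex \<Rightarrow> 'e::ab_group_add \<Rightarrow> 'e"
    and scaleF :: "complex \<Rightarrow> 'f::ab_group_add \<Rightarrow> 'f"
    and pairing :: "'f \<Rightarrow> 'e \<Rightarrow> complex"
    and D :: "'e set" and A :: "'e \<Rightarrow> 'f"
    and i ii iii iv :: bool
  assumes "anti_dual_pair scaleE scaleF pairing"
    and "weak_star_sequentially_complete pairing"
    and "linear_operator scaleE scaleF D A"
  defines "i \<equiv> (\<exists>T. positive_extension scaleE scaleF pairing D A T)"
    and "ii \<equiv> vs_bounded scaleF (strong_topology scaleE pairing) (W_set pairing D A)"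
    and "iii \<equiv> vs_bounded scaleF (weak_star_topology pairing) (W_set pairing D A)"
    and "iv \<equiv> (\<forall>y. \<exists>M::real. 0 \<le> M \<and>
           (\<forall>x\<in>D. complex_of_real ((cmod (pairing (A x) y))\<^sup>2) \<le> complex_of_real M * pairing (A x) x))"
  shows "(real_form pairing D A \<longrightarrow> (i \<longleftrightarrow> ii) \<and> (ii \<longleftrightarrow> iii) \<and> (iii \<longleftrightarrow> iv)) \<and>
         (i \<longleftrightarrow> iv) \<and> (ii \<longleftrightarrow> iii) \<and> (i \<longrightarrow> ii) \<and>
         (i \<longrightarrow> (\<exists>A\<^sub>N. positive_extension scaleE scaleF pairing D A A\<^sub>N \<and>
           (\<forall>T. positive_extension scaleE scaleF pairing D A T \<longrightarrow> operator_le pairing A\<^sub>N T)))"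
proof -
  interpret anti_dual_pair scaleE scaleF pairing by fact
  have i_iv: iv if i
    using that positive_extension_imp_dominated unfolding i_def iv_def by blast
  have iv_KvN: "\<exists>N. positive_extension scaleE scaleF pairing D A N \<and>
      (\<forall>T. positive_extension scaleE scaleF pairing D A T \<longrightarrow> operator_le pairing N T)" if iv
  proof -
    interpret dominated_operator scaleE scaleF pairing D A
      using dominated_operatorI[OF assms(2,3)] that unfolding iv_def by blast
    show ?thesis using KvN_extension_positive_extension KvN_extension_le by blast
  qed
  have iv_i: i if iv
    using iv_KvN[OF that] unfolding i_def by blast
  have iv_iii: iii if iv
    using that dominated_imp_weak_star_bounded unfolding iv_def iii_def by blast
  have ii_iii: "ii \<longleftrightarrow> iii"
    using vs_bounded_strong_imp_weak_star weak_star_bounded_imp_strong_bounded[OF assms(2)]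
    unfolding ii_def iii_def by blast
  \<comment> \<open>The one implication that rests on \<open>real_form\<close>, through the
    rescaling of vectors into \<open>W_set\<close>. The pointwise bounds are collected into a
    function \<open>C\<close> of \<open>y\<close>, and its square serves as the constant in
    (iv).\<close>
  have iii_iv: iv if iii "real_form pairing D A"
  proof -
    obtain C where "\<And>f y. f \<in> W_set pairing D A \<Longrightarrow> cmod (pairing f y) \<le> C y"
      using \<open>iii\<close> unfolding iii_def vs_bounded_weak_star_iff by metis
    from real_form_bounded_imp_dominated[OF assms(3) that(2) this] show ?thesis
      unfolding iv_def by (meson zero_le_power2)
  qed
  show ?thesis using i_iv iv_i iv_KvN iv_iii ii_iii iii_iv by blast
qed

end
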